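(* Let $\mathbf{M}_0=(\{S_i\}_{i\in I},\{T_i\}_{i\in I},\{P_i\}_{i\in I})$ be a strategic belief model of a game $G=\langle I,\{S_i\}_{i\in I},\{\Pi_i\}_{i\in I}\rangle$, with associated partially ordered family of forcing conditions $(\mathcal{P},\preceq)$ and associated set $\delta$. Then $$\mathcal{G}=\{\gamma\in\delta:\ \gamma=\langle(s_1,t_1),\dots,(s_n,t_n)\rangle\text{ with, for every }m\text{ and every }i,\ (s_i,t_i)\in R_i^m\}$$ is a generic set.
   Context: Game: $I=\{1,\dots,n\}$ is a set of players, each $S_i$ is a finite set of strategies, $S=\prod_{i\in I}S_i$, and $\Pi_i:S\to\mathbb{R}$ is player $i$'s payoff. The index $-i$ denotes the product over all players $j\neq i$. A subscript $|X$ denotes projection onto $X$. Strategic belief model: for each $i\in I$, $T_i$ is a set (the types of $i$) and $P_i$ is a correspondence assigning to each $t_i\in T_i$ a nonempty set $P_i[t_i]\subseteq S_{-i}\times T_{-i}$. A state of the game is an element $\langle(s_1,t_1),\dots,(s_n,t_n)\rangle$ of $\prod_i(S_i\times T_i)$; an event is a set of states of the game. Unfolding: $t_j\in P_i^1[t_i]$ (for $j\ne i$) if there exist $s_j\in S_j$ and $(s_{-ij},t_{-ij})\in\prod_{k\ne i,j}(S_k\times T_k)$ with $\langle(s_{-ij},t_{-ij}),(s_j,t_j)\rangle\in P_i[t_i]$. For $m\ge2$, $t_j\in P_i^m[t_i]$ if there is $t_k\in P_i^{m-1}[t_i]$ with $t_j\in P_k^1[t_k]$. Rationality: the event "$j$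 is rational" is the set of states of the game $\langle s_j,t_j;s_{-j},t_{-j}\rangle$ such that $\Pi_j(s_j,s'_{-j})\ge\Pi_j(s,s'_{-j})$ for all $s\in S_j$ and all $s'_{-j}\in P_j[t_j]_{|S_{-j}}$. Assumption: for an event $E$, $\mathcal{AS}_i[E]=\{t_i\in T_i: P_i[t_i]=E_{|\prod_{j\neq i}(S_j\times T_j)}\}$. For sets $E^j\subseteq S_j\times T_j$ ($j\ne i$), $\mathcal{AS}_i[\bigcap_{j\neq i}E^j]$ is understood by identifying each $E^j$ with the event of all states of the game whose $j$-component is in $E^j$. Rationality and assumption of rationality: $R_i^0=[i\text{ is rational}]_{|S_i\times T_i}$ and, for $m\ge1$, $R_i^m=R_i^{m-1}\cap\big(S_i\times\mathcal{AS}_i[\bigcap_{j\ne i}R_j^{m-1}]\big)$. Forcing conditions: $\mathcal{P}$ is the set of states of the game $\phi=\langle(s_1,t_1),\dots,(s_n,t_n)\rangle$ such that every $i$ is rational and there exists a natural number $m(\phi)$ such that $t_j\in P_i^{m(\phi)}[t_i]$ for any $i,j$; each $\phi\in\mathcal{P}$ is taken together with such a number $m(\phi)$. For $\phi,\phi'\in\mathcal{P}$, $\phi'\preceq\phi$ iff $m(\phi)\ge m(\phi')$. Correct set: a subset $C\subseteq\mathcal{P}$ is correct if (i) $\phi'\in C$ and $\phi'\preceq\phi$ imply $\phi\in C$, and (ii) for all $\phi',\phi''\in C$ there is $\phi\in C$ with $\phi'\preceq\phi$ and $\phi''\preceq\phi$. The set $\delta$: $\delta$ is the set of states of the game $\gamma=\langle(s_1,t_1),\dots,(s_n,t_n)\rangle$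 for which there exists a natural number $m(\gamma)\ge 0$ such that $(s_i,t_i)\in R_i^{m(\gamma)}$ for every $i$. Domination: a set $D\subseteq\mathcal{P}$ is a domination if for every $\phi'\in\mathcal{P}$ there is $\phi\in D$ with $\phi'\preceq\phi$. Generic set: a correct set $\mathcal{G}$ is generic if $\mathcal{G}\subseteq\delta$ and $\mathcal{G}\cap D\ne\emptyset$ for every domination $D$.
   Formalization: The formal theorem adds that 𝒢 is nonempty: 𝒫 is itself a domination, so a generic set cannot be empty, yet 𝒢 is empty in some models (e.g. constant payoffs, P_i[t_i] a single point). In the definition of 𝒫, "any i,j" is read as distinct i,j. *)

theory Defs
  imports Complex_Main "HOL-Library.FuncSet"
begin

text \<open>
  The players are \<open>{1..n}\<close>; the families \<open>S\<close>, \<open>T\<close>, \<open>P\<close>, \<open>pay\<close> (payoff functions) are indexed by players.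
  Products over players are extensional function spaces, so \<open>S\<^sub>-\<^sub>i \<times> T\<^sub>-\<^sub>i\<close> is
  \<open>profiles ({1..n} - {i}) S T\<close> and a state of the game is an element of \<open>profiles {1..n} S T\<close>.
\<close>

definition profiles ::
    "nat set \<Rightarrow> (nat \<Rightarrow> 's set) \<Rightarrow> (nat \<Rightarrow> 't set) \<Rightarrow> (nat \<Rightarrow> 's \<times> 't) set" where
  "profiles J S T = (\<Pi>\<^sub>E j\<in>J. S j \<times> T j)"

abbreviation states ::
    "nat \<Rightarrow> (nat \<Rightarrow> 's set) \<Rightarrow> (nat \<Rightarrow> 't set) \<Rightarrow> (nat \<Rightarrow> 's \<times> 't) set" where
  "states n S T \<equiv> profiles {1..n} S T"

definition strategic_belief_model ::
    "nat \<Rightarrow> (nat \<Rightarrow> 's set) \<Rightarrow> (nat \<Rightarrow> 't set) \<Rightarrow> (nat \<Rightarrow> 't \<Rightarrow> (nat \<Rightarrow> 's \<times> 't) set) \<Rightarrow> bool" where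
  "strategic_belief_model n S T P \<longleftrightarrow>
     (\<forall>i\<in>{1..n}. \<forall>t\<in>T i. P i t \<noteq> {} \<and> P i t \<subseteq> profiles ({1..n} - {i}) S T)"

text \<open>
  The type sets of all players live in one HOL type, so the unfolding records the owner of each
  type: \<open>(j, t\<^sub>j) \<in> unfold n S T P m i t\<^sub>i\<close> stands for \<open>t\<^sub>j \<in> P\<^sub>i\<^sup>m[t\<^sub>i]\<close>.
  The unfolding exists only for \<open>m \<ge> 1\<close>; it is set to be empty for \<open>m = 0\<close>.
\<close>

definition unfold1 ::
    "nat \<Rightarrow> (nat \<Rightarrow> 's set) \<Rightarrow> (nat \<Rightarrow> 't set) \<Rightarrow> (nat \<Rightarrow> 't \<Rightarrow> (nat \<Rightarrow> 's \<times> 't) set) \<Rightarrow>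
     nat \<Rightarrow> 't \<Rightarrow> (nat \<times> 't) set" where
  "unfold1 n S T P i ti =
     {(j, tj). j \<in> {1..n} - {i} \<and> tj \<in> T j \<and>
        (\<exists>sj\<in>S j. \<exists>w\<in>profiles ({1..n} - {i, j}) S T. w(j := (sj, tj)) \<in> P i ti)}"

fun unfold ::
    "nat \<Rightarrow> (nat \<Rightarrow> 's set) \<Rightarrow> (nat \<Rightarrow> 't set) \<Rightarrow> (nat \<Rightarrow> 't \<Rightarrow> (nat \<Rightarrow> 's \<times> 't) set) \<Rightarrow>
     nat \<Rightarrow> nat \<Rightarrow> 't \<Rightarrow> (nat \<times> 't) set" where
  "unfold n S T P 0 i ti = {}"
| "unfold n S T P (Suc 0) i ti = unfold1 n S T P i ti"
| "unfold n S T P (Suc (Suc m)) i ti =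
     (\<Union>(k, tk) \<in> unfold n S T P (Suc m) i ti. unfold1 n S T P k tk)"

definition strategy_proj ::
    "nat set \<Rightarrow> (nat \<Rightarrow> 's \<times> 't) set \<Rightarrow> (nat \<Rightarrow> 's) set" where
  "strategy_proj J X = (\<lambda>x. \<lambda>j\<in>J. fst (x j)) ` X"

definition rational ::
    "nat \<Rightarrow> (nat \<Rightarrow> 's set) \<Rightarrow> (nat \<Rightarrow> (nat \<Rightarrow> 's) \<Rightarrow> real) \<Rightarrow> (nat \<Rightarrow> 't set) \<Rightarrow>
     (nat \<Rightarrow> 't \<Rightarrow> (nat \<Rightarrow> 's \<times> 't) set) \<Rightarrow> nat \<Rightarrow> (nat \<Rightarrow> 's \<times> 't) set" where
  "rational n S pay T P j =
     {x \<in> states n S T. \<forall>s\<in>S j. \<forall>s'\<in>strategy_proj ({1..n} - {j}) (P j (snd (x j))).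
        pay j (s'(j := fst (x j))) \<ge> pay j (s'(j := s))}"

definition assumes_event ::
    "nat \<Rightarrow> (nat \<Rightarrow> 't set) \<Rightarrow> (nat \<Rightarrow> 't \<Rightarrow> (nat \<Rightarrow> 's \<times> 't) set) \<Rightarrow> nat \<Rightarrow>
     (nat \<Rightarrow> 's \<times> 't) set \<Rightarrow> 't set" where
  "assumes_event n T P i E = {t \<in> T i. P i t = (\<lambda>x. restrict x ({1..n} - {i})) ` E}"

fun R ::
    "nat \<Rightarrow> (nat \<Rightarrow> 's set) \<Rightarrow> (nat \<Rightarrow> (nat \<Rightarrow> 's) \<Rightarrow> real) \<Rightarrow> (nat \<Rightarrow> 't set) \<Rightarrow>
     (nat \<Rightarrow> 't \<Rightarrow> (nat \<Rightarrow> 's \<times> 't) set) \<Rightarrow> nat \<Rightarrow> nat \<Rightarrow> ('s \<times> 't) set" where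
  "R n S pay T P 0 i = (\<lambda>x. x i) ` rational n S pay T P i"
| "R n S pay T P (Suc m) i =
     R n S pay T P m i \<inter>
     (S i \<times> assumes_event n T P i {x \<in> states n S T. \<forall>j\<in>{1..n} - {i}. x j \<in> R n S pay T P m j})"

text \<open>
  Mutual reachability is required of distinct players only: \<open>P\<^sub>i\<^sup>1[t\<^sub>i]\<close> contains types of opponents
  only, and with two players \<open>P\<^sub>i\<^sup>m[t\<^sub>i]\<close> alternates between the types of the two players, so that
  no \<open>m\<close> could serve \<open>i = j\<close> and \<open>i \<noteq> j\<close> at once.
\<close>

definition mutually_reachable ::
    "nat \<Rightarrow> (nat \<Rightarrow> 's set) \<Rightarrow> (nat \<Rightarrow> 't set) \<Rightarrow> (nat \<Rightarrow> 't \<Rightarrow> (nat \<Rightarrow> 's \<times> 't) set) \<Rightarrow>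
     nat \<Rightarrow> (nat \<Rightarrow> 's \<times> 't) \<Rightarrow> bool" where
  "mutually_reachable n S T P m x \<longleftrightarrow> m \<ge> 1 \<and>
     (\<forall>i\<in>{1..n}. \<forall>j\<in>{1..n} - {i}. (j, snd (x j)) \<in> unfold n S T P m i (snd (x i)))"

definition forcing_conditions ::
    "nat \<Rightarrow> (nat \<Rightarrow> 's set) \<Rightarrow> (nat \<Rightarrow> (nat \<Rightarrow> 's) \<Rightarrow> real) \<Rightarrow> (nat \<Rightarrow> 't set) \<Rightarrow>
     (nat \<Rightarrow> 't \<Rightarrow> (nat \<Rightarrow> 's \<times> 't) set) \<Rightarrow> (nat \<Rightarrow> 's \<times> 't) set" where
  "forcing_conditions n S pay T P =
     {x \<in> states n S T. (\<forall>i\<in>{1..n}. x \<in> rational n S pay T P i) \<and>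
        (\<exists>m. mutually_reachable n S T P m x)}"

text \<open>
  \<open>mu\<close> is the assignment \<open>\<phi> \<mapsto> m(\<phi>)\<close> of a number to each forcing condition.
\<close>

definition forcing_degree ::
    "nat \<Rightarrow> (nat \<Rightarrow> 's set) \<Rightarrow> (nat \<Rightarrow> (nat \<Rightarrow> 's) \<Rightarrow> real) \<Rightarrow> (nat \<Rightarrow> 't set) \<Rightarrow>
     (nat \<Rightarrow> 't \<Rightarrow> (nat \<Rightarrow> 's \<times> 't) set) \<Rightarrow> ((nat \<Rightarrow> 's \<times> 't) \<Rightarrow> nat) \<Rightarrow> bool" where
  "forcing_degree n S pay T P mu \<longleftrightarrow>
     (\<forall>x\<in>forcing_conditions n S pay T P. mutually_reachable n S T P (mu x) x)"

definition weaker :: "('a \<Rightarrow> nat) \<Rightarrow> 'a \<Rightarrow> 'a \<Rightarrow> bool" where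
  "weaker mu x' x \<longleftrightarrow> mu x \<ge> mu x'"

definition correct_set :: "'a set \<Rightarrow> ('a \<Rightarrow> 'a \<Rightarrow> bool) \<Rightarrow> 'a set \<Rightarrow> bool" where
  "correct_set Ps le C \<longleftrightarrow> C \<subseteq> Ps \<and>
     (\<forall>x'\<in>C. \<forall>x\<in>Ps. le x' x \<longrightarrow> x \<in> C) \<and>
     (\<forall>x'\<in>C. \<forall>x''\<in>C. \<exists>x\<in>C. le x' x \<and> le x'' x)"

definition delta ::
    "nat \<Rightarrow> (nat \<Rightarrow> 's set) \<Rightarrow> (nat \<Rightarrow> (nat \<Rightarrow> 's) \<Rightarrow> real) \<Rightarrow> (nat \<Rightarrow> 't set) \<Rightarrow>
     (nat \<Rightarrow> 't \<Rightarrow> (nat \<Rightarrow> 's \<times> 't) set) \<Rightarrow> (nat \<Rightarrow> 's \<times> 't) set" where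
  "delta n S pay T P = {x \<in> states n S T. \<exists>m. \<forall>i\<in>{1..n}. x i \<in> R n S pay T P m i}"

definition domination :: "'a set \<Rightarrow> ('a \<Rightarrow> 'a \<Rightarrow> bool) \<Rightarrow> 'a set \<Rightarrow> bool" where
  "domination Ps le D \<longleftrightarrow> D \<subseteq> Ps \<and> (\<forall>x'\<in>Ps. \<exists>x\<in>D. le x' x)"

definition generic_set :: "'a set \<Rightarrow> ('a \<Rightarrow> 'a \<Rightarrow> bool) \<Rightarrow> 'a set \<Rightarrow> 'a set \<Rightarrow> bool" where
  "generic_set Ps le dl G \<longleftrightarrow>
     correct_set Ps le G \<and> G \<subseteq> dl \<and> (\<forall>D. domination Ps le D \<longrightarrow> G \<inter> D \<noteq> {})"

text \<open>
  The set of all conditions is itself a domination, so a generic set is never empty.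
  Hence a set that is empty in some models can be generic only under a nonemptiness hypothesis.
\<close>

lemma generic_set_nonempty: "generic_set Ps (weaker mu) dl G \<Longrightarrow> G \<noteq> {}"
  unfolding generic_set_def domination_def weaker_def by blast

end

theory Submission
  imports Defs
begin

text \<open>
  A type assumes an event only if its belief set is \<^emph>\<open>equal\<close> to the projection of that event. One
  state \<open>x\<close> that lies in \<open>R\<^sup>m\<close> for every \<open>m\<close> therefore freezes the whole hierarchy: the single set
  \<open>P\<^sub>i[t\<^sub>i]\<close> has to equal \<open>\<Prod>\<^sub>j\<^sub>\<noteq>\<^sub>i R\<^sub>j\<^sup>m\<close> for every \<open>m\<close> at once. Since these products are nonempty (they
  contain the projection of \<open>x\<close>), their factors do not depend on \<open>m\<close>, so \<open>R\<^sub>j\<^sup>m = R\<^sub>j\<^sup>0\<close> (\<open>R_eq_R_0\<close>,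
  which also covers a lone player, whose beliefs are trivial). Hence every state at which all players are rational belongs to \<open>\<G>\<close>.

  Conversely, at a state of \<open>\<G>\<close> each \<open>t\<^sub>i\<close> assumes rationality of the opponents, and the actual
  state is one of those at which they are rational. So each type holds the actual opponents' types
  possible, and the state is mutually reachable already with \<open>m = 1\<close>
  (\<open>mutually_reachable_1_if_R_1\<close>). Thus \<open>\<G>\<close> is the set of \<^emph>\<open>all\<close> forcing conditions. That set is
  upward closed, directed because \<open>\<preceq>\<close> compares natural numbers and so any two conditions are
  comparable, and it meets every domination as soon as it is nonempty.
\<close>

text \<open>
  Whether \<open>j\<close> is rational at a state depends on the \<open>j\<close>-component alone, so nothing is lost in
  passing from the event to its projection \<open>R\<^sub>j\<^sup>0\<close>.
\<close>

lemma rational_iff_R_0: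
  assumes "x \<in> states n S T"
  shows "x \<in> rational n S pay T P j \<longleftrightarrow> x j \<in> R n S pay T P 0 j"
  using assms by (auto simp: rational_def)

lemma R_0_subset:
  assumes "j \<in> {1..n}"
  shows "R n S pay T P 0 j \<subseteq> S j \<times> T j"
  using assms by (auto simp: rational_def profiles_def dest!: PiE_mem)

lemma R_Suc_belief:
  assumes "y \<in> R n S pay T P (Suc m) i"
  shows "P i (snd y) = (\<lambda>x. restrict x ({1..n} - {i})) `
           {x \<in> states n S T. \<forall>j\<in>{1..n} - {i}. x j \<in> R n S pay T P m j}"
  using assms by (auto simp: assumes_event_def)

text \<open>
  The belief set of \<open>i\<close>'s type at \<open>x\<close> is the common value of all the products \<open>\<Prod>\<^sub>k\<^sub>\<noteq>\<^sub>i R\<^sub>k\<^sup>m\<close>. Replacing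
  the \<open>j\<close>-component of \<open>x\<close> by a member of \<open>R\<^sub>j\<^sup>0\<close> gives a point of the product for \<open>m = 0\<close>, hence
  of the product for any \<open>m\<close>.
\<close>

lemma R_0_subset_R_if_opponent:
  assumes x: "x \<in> states n S T" and xR: "\<And>m k. k \<in> {1..n} \<Longrightarrow> x k \<in> R n S pay T P m k"
    and i: "i \<in> {1..n}" and j: "j \<in> {1..n}" and "i \<noteq> j"
  shows "R n S pay T P 0 j \<subseteq> R n S pay T P m j"
proof
  fix y assume y: "y \<in> R n S pay T P 0 j"
  define proj where "proj = (\<lambda>x :: nat \<Rightarrow> 'a \<times> 'b. restrict x ({1..n} - {i}))"
  define E where
    "E m = {x \<in> states n S T. \<forall>k\<in>{1..n} - {i}. x k \<in> R n S pay T P m k}" for m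
  have belief: "P i (snd (x i)) = proj ` E m" for m
    unfolding proj_def E_def by (rule R_Suc_belief[OF xR[OF i]])
  have yST: "y \<in> S j \<times> T j"
    using y R_0_subset[OF j, of S pay T P] by (rule rev_subsetD)
  have "x(j := y) \<in> states n S T"
    unfolding profiles_def
  proof (rule PiE_I)
    fix k assume "k \<in> {1..n}"
    with x yST show "(x(j := y)) k \<in> S k \<times> T k"
      by (auto simp: profiles_def dest: PiE_mem)
  next
    fix k assume "k \<notin> {1..n}"
    with x j show "(x(j := y)) k = undefined"
      by (auto simp: profiles_def dest: PiE_arb)
  qed
  then have "x(j := y) \<in> E 0"
    using y xR[of _ 0] by (auto simp: E_def simp del: R.simps)
  then have "proj (x(j := y)) \<in> proj ` E m"
    using belief[of 0] belief[of m] by blast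
  then obtain z where z: "z \<in> E m" "proj (x(j := y)) = proj z"
    by blast
  have "z j = y"
    using fun_cong[OF z(2), of j] j \<open>i \<noteq> j\<close> by (simp add: proj_def)
  then show "y \<in> R n S pay T P m j"
    using z(1) j \<open>i \<noteq> j\<close> by (auto simp: E_def)
qed

text \<open>
  A lone player has no opponents to hold beliefs about: the only nonempty belief set is the singleton
  of the empty profile, and every type assumes every nonempty event.
\<close>

lemma R_Suc_eq_if_single_player:
  assumes model: "strategic_belief_model n S T P"
    and x: "x \<in> states n S T" and i: "i \<in> {1..n}" and single: "{1..n} - {i} = {}"
    and sub: "R n S pay T P m i \<subseteq> S i \<times> T i"
  shows "R n S pay T P (Suc m) i = R n S pay T P m i"
proof -
  have belief: "P i t = {\<lambda>_. undefined}" if "t \<in> T i" for t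
  proof -
    have "P i t \<noteq> {}" "P i t \<subseteq> profiles ({1..n} - {i}) S T"
      using model that i unfolding strategic_belief_model_def by blast+
    then show ?thesis unfolding single by (auto simp: profiles_def)
  qed
  have "(\<lambda>x. restrict x {}) ` states n S T = {\<lambda>_. undefined}"
    using x by (auto simp: restrict_def)
  with belief have "assumes_event n T P i
      {x \<in> states n S T. \<forall>j\<in>{1..n} - {i}. x j \<in> R n S pay T P m j} = T i"
    unfolding assumes_event_def single by auto
  with sub show ?thesis by auto
qed

text \<open>
  The collapse of the hierarchy. Every player who has an opponent is the subject of that
  opponent's assumptions, so the two preceding lemmas cover all cases.
\<close>

lemma R_eq_R_0:
  assumes model: "strategic_belief_model n S T P"
    and x: "x \<in> states n S T" and xR: "\<And>m k. k \<in> {1..n} \<Longrightarrow> x k \<in> R n S pay T P m k"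
    and j: "j \<in> {1..n}"
  shows "R n S pay T P m j = R n S pay T P 0 j"
proof (cases "{1..n} - {j} = {}")
  case True
  show ?thesis
  proof (induction m)
    case (Suc m)
    have "R n S pay T P m j \<subseteq> S j \<times> T j"
      unfolding Suc.IH by (rule R_0_subset[OF j])
    from R_Suc_eq_if_single_player[OF model x j True this] Suc.IH show ?case
      by (rule trans)
  qed (rule refl)
next
  case False
  then obtain i where "i \<in> {1..n}" "i \<noteq> j" by blast
  then have "R n S pay T P 0 j \<subseteq> R n S pay T P m j"
    using R_0_subset_R_if_opponent[OF x xR _ j] by blast
  moreover have "R n S pay T P m j \<subseteq> R n S pay T P 0 j"
    by (induction m) auto
  ultimately show ?thesis by (rule equalityI[rotated])
qed

text \<open>
  The belief set of each type is the set of all opponents' profiles consistent with rationality,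
  and the actual profile of the opponents is one of these.
\<close>

lemma mutually_reachable_1_if_R_1:
  assumes x: "x \<in> states n S T" and xR: "\<And>m k. k \<in> {1..n} \<Longrightarrow> x k \<in> R n S pay T P m k"
  shows "mutually_reachable n S T P 1 x"
proof -
  have "(j, snd (x j)) \<in> unfold1 n S T P i (snd (x i))"
    if i: "i \<in> {1..n}" and j: "j \<in> {1..n} - {i}" for i j
  proof -
    let ?w = "restrict x ({1..n} - {i, j})"
    have "restrict x ({1..n} - {i}) \<in> P i (snd (x i))"
      unfolding R_Suc_belief[OF xR[OF i], of 0] using x xR[of _ 0] by blast
    moreover have "?w(j := x j) = restrict x ({1..n} - {i})"
      using j by (auto simp: restrict_def)
    ultimately have "?w(j := (fst (x j), snd (x j))) \<in> P i (snd (x i))"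
      by simp
    moreover have "?w \<in> profiles ({1..n} - {i, j}) S T"
      using x by (auto simp: profiles_def dest: PiE_mem)
    moreover have "x j \<in> S j \<times> T j"
      using PiE_mem[OF x[unfolded profiles_def], of j] j by simp
    then have "fst (x j) \<in> S j" "snd (x j) \<in> T j"
      by (simp_all add: mem_Times_iff)
    ultimately show ?thesis
      using j unfolding unfold1_def by blast
  qed
  then show ?thesis by (simp add: mutually_reachable_def)
qed

text \<open>
  Directedness holds because \<open>\<preceq>\<close> is total: of two conditions the one of larger degree is
  stronger than both.
\<close>

lemma generic_set_all_conditions:
  assumes "Ps \<subseteq> dl" and "Ps \<noteq> {}"
  shows "generic_set Ps (weaker mu) dl Ps"
proof -
  have "\<exists>x\<in>Ps. weaker mu x' x \<and> weaker mu x'' x" if "x' \<in> Ps" "x'' \<in> Ps" for x' x''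
    using that unfolding weaker_def by (meson linear order_refl)
  then show ?thesis
    using assms unfolding generic_set_def correct_set_def domination_def by blast
qed

theorem theorem2:
  fixes n :: nat
    and S :: "nat \<Rightarrow> 's set"
    and pay :: "nat \<Rightarrow> (nat \<Rightarrow> 's) \<Rightarrow> real"
    and T :: "nat \<Rightarrow> 't set"
    and P :: "nat \<Rightarrow> 't \<Rightarrow> (nat \<Rightarrow> 's \<times> 't) set"
    and mu :: "(nat \<Rightarrow> 's \<times> 't) \<Rightarrow> nat"
    and G :: "(nat \<Rightarrow> 's \<times> 't) set"
  assumes finite_strategies: "\<forall>i\<in>{1..n}. finite (S i)"
    and model: "strategic_belief_model n S T P"
    and degree: "forcing_degree n S pay T P mu"
    and G_eq: "G = {x \<in> delta n S pay T P. \<forall>m. \<forall>i\<in>{1..n}. x i \<in> R n S pay T P m i}"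
    and G_nonempty: "G \<noteq> {}"
  shows "generic_set (forcing_conditions n S pay T P) (weaker mu) (delta n S pay T P) G"
proof -
  obtain x0 where x0: "x0 \<in> states n S T"
      and x0R: "\<And>m k. k \<in> {1..n} \<Longrightarrow> x0 k \<in> R n S pay T P m k"
    using G_nonempty unfolding G_eq delta_def by blast
  note collapse = R_eq_R_0[OF model x0 x0R]
  have "G = forcing_conditions n S pay T P"
  proof
    show "G \<subseteq> forcing_conditions n S pay T P"
    proof
      fix x assume "x \<in> G"
      then have x: "x \<in> states n S T"
          and xR: "\<And>m k. k \<in> {1..n} \<Longrightarrow> x k \<in> R n S pay T P m k"
        unfolding G_eq delta_def by blast+
      have "mutually_reachable n S T P 1 x"
        by (rule mutually_reachable_1_if_R_1[OF x xR])
      then show "x \<in> forcing_conditions n S pay T P"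
        using x xR[of _ 0] rational_iff_R_0[OF x]
        unfolding forcing_conditions_def by blast
    qed
  next
    show "forcing_conditions n S pay T P \<subseteq> G"
    proof
      fix x assume "x \<in> forcing_conditions n S pay T P"
      then have x: "x \<in> states n S T" and "\<forall>i\<in>{1..n}. x \<in> rational n S pay T P i"
        unfolding forcing_conditions_def by blast+
      then have "x i \<in> R n S pay T P m i" if "i \<in> {1..n}" for m i
        using rational_iff_R_0[OF x] collapse[OF _ that] that by blast
      with x show "x \<in> G"
        unfolding G_eq delta_def by blast
    qed
  qed
  moreover have "G \<subseteq> delta n S pay T P"
    unfolding G_eq by blast
  ultimately show ?thesis
    using generic_set_all_conditions G_nonempty by metis
qed

end
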